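(* There exists a universal constant $c>0$ such that the following holds. Let $n\ge1$, let $x_1,\dots,x_n\in[0,1]$, let $L>0$, and let $\varphi:[0,1]^n\to\mathbb{R}$ be an $L$-Lipschitz convex function. Let $\pi$ be a uniform random permutation of the set $\{1,\dots,n\}$ and let $Z=\varphi(x_{\pi(1)},\dots,x_{\pi(n)})$. Then for all $t>0$, $$\mathbb{P}(|Z-\mathbb{E}Z|\ge t)\le 2\exp(-ct^2/L^2).$$
   Context: Lipschitz is understood with respect to the Euclidean norm on $\mathbb{R}^n$. "Universal constant" means that $c$ depends on no parameter of the problem (not on $n$, the $x_i$, $\varphi$, $L$ or $t$). *)

theory Defs
  imports "HOL-Probability.Probability" "HOL-Combinatorics.Permutations"
begin

text \<open>
  The constant in the theorem must not depend on the dimension \<open>n\<close>, so \<open>n\<close> has to be quantified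
  inside the statement and cannot be the index type of \<open>real ^ 'n\<close>. A point of
  \<open>[0,1]\<^sup>n\<close> is therefore a function on \<open>{1..n}\<close>, extensional (that is, \<open>undefined\<close>) outside
  \<open>{1..n}\<close>, so that different functions are different points. As function spaces carry neither
  a Euclidean metric nor a real vector space structure in the library, \<open>lipschitz_on\<close> and
  \<open>convex_on\<close> are spelled out below in coordinates.
\<close>

definition unit_cube :: "nat \<Rightarrow> (nat \<Rightarrow> real) set" where
  "unit_cube n = {1..n} \<rightarrow>\<^sub>E {0..1}"

definition euclidean_dist :: "nat \<Rightarrow> (nat \<Rightarrow> real) \<Rightarrow> (nat \<Rightarrow> real) \<Rightarrow> real" where
  "euclidean_dist n a b = L2_set (\<lambda>i. a i - b i) {1..n}"

definition lipschitz_on_cube :: "nat \<Rightarrow> real \<Rightarrow> ((nat \<Rightarrow> real) \<Rightarrow> real) \<Rightarrow> bool" where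
  "lipschitz_on_cube n L \<phi> \<longleftrightarrow>
     0 \<le> L \<and> (\<forall>a\<in>unit_cube n. \<forall>b\<in>unit_cube n. \<bar>\<phi> a - \<phi> b\<bar> \<le> L * euclidean_dist n a b)"

definition convex_on_cube :: "nat \<Rightarrow> ((nat \<Rightarrow> real) \<Rightarrow> real) \<Rightarrow> bool" where
  "convex_on_cube n \<phi> \<longleftrightarrow>
     (\<forall>a\<in>unit_cube n. \<forall>b\<in>unit_cube n. \<forall>u\<ge>0. \<forall>v\<ge>0. u + v = 1 \<longrightarrow>
        \<phi> (\<lambda>i\<in>{1..n}. u * a i + v * b i) \<le> u * \<phi> a + v * \<phi> b)"

definition uniform_permutation :: "nat \<Rightarrow> (nat \<Rightarrow> nat) pmf" where
  "uniform_permutation n = pmf_of_set {\<pi>. \<pi> permutes {1..n}}"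

definition permuted_value ::
    "nat \<Rightarrow> (nat \<Rightarrow> real) \<Rightarrow> ((nat \<Rightarrow> real) \<Rightarrow> real) \<Rightarrow> (nat \<Rightarrow> nat) \<Rightarrow> real" where
  "permuted_value n x \<phi> \<pi> = \<phi> (\<lambda>i\<in>{1..n}. x (\<pi> i))"

end

theory Submission
  imports Defs
begin

text \<open>
  Uniform permutations satisfy a modified logarithmic Sobolev inequality for random transpositions:
  the chain rule for entropy, conditioned on the value at one point \<open>l\<close> and averaged over \<open>l\<close>,
  gives it by induction with constant \<open>1 / (2 n)\<close>. Apply it to \<open>exp (s D)\<close>, where \<open>D\<close> is the squared
  Euclidean distance from the permuted vector to the compact convex sublevel set \<open>{\<phi> \<le> a}\<close>. As half
  the gradient of \<open>D\<close> is the vector \<open>v\<close> from the projection, with \<open>D = |v|\<^sup>2\<close> and entries of modulus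
  at most 1, \<open>D\<close> is self-bounding: \<open>(1/n) \<Sum>\<^sub>i\<^sub>j ((D - D\<^sub>i\<^sub>j)\<^sub>+)\<^sup>2 \<le> 8 D\<close>, with jumps at most 4. Herbst's
  argument then bounds the exponential moments of \<open>D\<close> for \<open>s\<close> of either sign, and multiplying the
  two bounds yields \<open>P(Z \<le> a) E exp (((Z - a)\<^sub>+)\<^sup>2 / (64 L\<^sup>2)) \<le> 1\<close>, an inequality of Talagrand
  type. The lower tail around the mean follows at once by Jensen's inequality; it bounds
  \<open>E (Z - E Z)\<^sub>+ = E (E Z - Z)\<^sub>+\<close>, so that \<open>P(Z \<le> E Z + 66 L) \<ge> 1/2\<close>, and the upper tail follows too.
\<close>

hide_const (open) Finite_Cartesian_Product.transpose

subsection \<open>Averages over permutations\<close>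

text \<open>The set \<open>S\<close> is arbitrary so that the induction for the Sobolev inequality
  can remove a point; a plain finite sum keeps all manipulations algebraic until
  \<open>expectation_uniform_permutation\<close> connects it with the probability space.\<close>

definition perm_avg :: "'a set \<Rightarrow> (('a \<Rightarrow> 'a) \<Rightarrow> real) \<Rightarrow> real" where
  "perm_avg S f = (\<Sum>p | p permutes S. f p) / fact (card S)"

lemma perm_avg_cong:
  assumes "\<And>p. p permutes S \<Longrightarrow> f p = g p"
  shows "perm_avg S f = perm_avg S g"
  using assms by (simp add: perm_avg_def)

lemma perm_avg_mono:
  assumes "\<And>p. p permutes S \<Longrightarrow> f p \<le> g p"
  shows "perm_avg S f \<le> perm_avg S g"
  unfolding perm_avg_def by (intro divide_right_mono sum_mono) (use assms in auto)

lemma perm_avg_nonneg: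
  assumes "\<And>p. p permutes S \<Longrightarrow> 0 \<le> f p"
  shows "0 \<le> perm_avg S f"
  unfolding perm_avg_def by (intro divide_nonneg_pos sum_nonneg) (use assms in auto)

lemma perm_avg_add: "perm_avg S (\<lambda>p. f p + g p) = perm_avg S f + perm_avg S g"
  by (simp add: perm_avg_def sum.distrib add_divide_distrib)

lemma perm_avg_diff: "perm_avg S (\<lambda>p. f p - g p) = perm_avg S f - perm_avg S g"
  by (simp add: perm_avg_def sum_subtractf diff_divide_distrib)

lemma perm_avg_cmult: "perm_avg S (\<lambda>p. c * f p) = c * perm_avg S f"
  by (simp add: perm_avg_def sum_distrib_left)

lemma perm_avg_cmult_right: "perm_avg S (\<lambda>p. f p * c) = perm_avg S f * c"
  by (simp add: perm_avg_def sum_distrib_right)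

lemma perm_avg_sum: "perm_avg S (\<lambda>p. \<Sum>i\<in>I. f i p) = (\<Sum>i\<in>I. perm_avg S (f i))"
  unfolding perm_avg_def by (subst sum.swap) (simp add: sum_divide_distrib)

lemma perm_avg_const [simp]:
  assumes "finite S"
  shows "perm_avg S (\<lambda>p. c) = c"
  using assms by (simp add: perm_avg_def card_permutations[OF refl])

lemma perm_avg_pos:
  assumes "finite S" "\<And>p. p permutes S \<Longrightarrow> 0 < f p"
  shows "0 < perm_avg S f"
proof -
  have "0 < (\<Sum>p | p permutes S. f p)"
    using assms by (intro sum_pos) (auto simp: finite_permutations intro: permutes_id)
  then show ?thesis by (simp add: perm_avg_def)
qed

lemma perm_avg_square_le:
  assumes S: "finite S"
  shows "(perm_avg S w)\<^sup>2 \<le> perm_avg S (\<lambda>p. (w p)\<^sup>2)"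
proof -
  let ?m = "perm_avg S w"
  have "0 \<le> perm_avg S (\<lambda>p. (w p - ?m)\<^sup>2)" by (rule perm_avg_nonneg) simp
  also have "\<dots> = perm_avg S (\<lambda>p. (w p)\<^sup>2 + ?m\<^sup>2 - 2 * ?m * w p)"
    by (rule perm_avg_cong) (simp add: power2_diff)
  also have "\<dots> = perm_avg S (\<lambda>p. (w p)\<^sup>2) + ?m\<^sup>2 - 2 * ?m * ?m"
    using S by (simp only: perm_avg_add perm_avg_diff perm_avg_cmult perm_avg_const)
  finally show ?thesis by (simp add: power2_eq_square)
qed

lemma perm_avg_compose_left:
  assumes "r permutes S"
  shows "perm_avg S (\<lambda>p. f (r \<circ> p)) = perm_avg S f"
  using setum_permutations_compose_left[OF assms, of f] by (simp add: perm_avg_def)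

lemma perm_avg_compose_right:
  assumes "r permutes S"
  shows "perm_avg S (\<lambda>p. f (p \<circ> r)) = perm_avg S f"
  using sum_permutations_compose_right[OF assms, of f] by (simp add: perm_avg_def)

text \<open>Each permutation of \<open>S\<close> is uniquely \<open>transpose l b \<circ> q\<close>
  with \<open>q\<close> fixing \<open>l\<close>, and \<open>b\<close> is then the image of
  \<open>l\<close>. The inner averages are thus the conditional expectations given the value at
  \<open>l\<close>.\<close>

lemma perm_avg_split:
  assumes "finite S" "l \<in> S"
  shows "perm_avg S f = (\<Sum>b\<in>S. perm_avg (S - {l}) (\<lambda>q. f (transpose l b \<circ> q))) / card S"
proof -
  have S: "insert l (S - {l}) = S" using assms by auto
  have card: "card S = Suc (card (S - {l}))" using assms by (rule card.remove)
  have "(\<Sum>p | p permutes S. f p)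
      = (\<Sum>b\<in>S. \<Sum>q | q permutes (S - {l}). f (transpose l b \<circ> q))"
    using sum_over_permutations_insert[of "S - {l}" l f] assms S by simp
  then show ?thesis
    by (simp only: perm_avg_def card fact_Suc sum_divide_distrib[symmetric] divide_divide_eq_left of_nat_mult mult.commute)
qed

subsection \<open>Modified logarithmic Sobolev inequality\<close>

definition perm_ent :: "'a set \<Rightarrow> (('a \<Rightarrow> 'a) \<Rightarrow> real) \<Rightarrow> real" where
  "perm_ent S f = perm_avg S (\<lambda>p. f p * ln (f p)) - perm_avg S f * ln (perm_avg S f)"

text \<open>This is the integrand of the Dirichlet form of \<open>f\<close> against
  \<open>ln f\<close>, the right-hand side of a modified logarithmic Sobolev inequality.\<close>

definition ln_gap :: "real \<Rightarrow> real \<Rightarrow> real" where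
  "ln_gap u v = (u - v) * (ln u - ln v)"

section \<open>Joint convexity of the logarithmic gap\<close>

lemma ln_gap_nonneg: "0 < u \<Longrightarrow> 0 < v \<Longrightarrow> 0 \<le> ln_gap u v"
  unfolding ln_gap_def by (cases "u \<le> v") (auto intro: mult_nonneg_nonneg mult_nonpos_nonpos)

lemma ln_gap_same [simp]: "ln_gap u u = 0"
  by (simp add: ln_gap_def)

lemma ln_gap_commute: "ln_gap u v = ln_gap v u"
  by (simp add: ln_gap_def algebra_simps)

lemma ln_gap_eq:
  assumes "0 < u" "0 < v"
  shows "ln_gap u v = u * ln (u / v) + v * ln (v / u)"
  using assms by (simp add: ln_gap_def ln_div algebra_simps)

text \<open>The log-sum inequality, that is, Jensen for the jointly convex function u ln (u / v).
  The tangent bound ln t <= t - 1 at t = \<open>v p * U / (u p * V)\<close> gives a pointwise lower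
  bound linear in \<open>u p\<close> and \<open>v p\<close>, which is then averaged.\<close>

lemma log_sum_perm_avg:
  assumes "finite S" and u: "\<And>p. p permutes S \<Longrightarrow> 0 < u p" and v: "\<And>p. p permutes S \<Longrightarrow> 0 < v p"
  shows "perm_avg S u * ln (perm_avg S u / perm_avg S v) \<le> perm_avg S (\<lambda>p. u p * ln (u p / v p))"
proof -
  define U V where "U = perm_avg S u" and "V = perm_avg S v"
  have U: "0 < U" and V: "0 < V"
    unfolding U_def V_def using assms by (auto intro: perm_avg_pos)
  have "u p * (ln (U / V) + 1) - v p * (U / V) \<le> u p * ln (u p / v p)" if "p permutes S" for p
  proof -
    have up: "0 < u p" and vp: "0 < v p" using u v that by auto
    let ?t = "v p * U / (u p * V)"
    have "ln ?t \<le> ?t - 1"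
      using up vp U V by (intro ln_le_minus_one) simp
    moreover have "ln ?t = ln (U / V) - ln (u p / v p)"
      using up vp U V by (simp add: ln_div ln_mult)
    ultimately have "ln (U / V) + 1 - ?t \<le> ln (u p / v p)" by simp
    then have "u p * (ln (U / V) + 1 - ?t) \<le> u p * ln (u p / v p)"
      using up by (intro mult_left_mono) auto
    then show ?thesis using up by (simp add: field_simps)
  qed
  then have "perm_avg S (\<lambda>p. u p * (ln (U / V) + 1) - v p * (U / V))
      \<le> perm_avg S (\<lambda>p. u p * ln (u p / v p))"
    by (rule perm_avg_mono)
  then have "U * (ln (U / V) + 1) - V * (U / V) \<le> perm_avg S (\<lambda>p. u p * ln (u p / v p))"
    by (simp only: perm_avg_diff perm_avg_cmult_right flip: U_def V_def)
  then show ?thesis using V by (simp add: algebra_simps flip: U_def V_def)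
qed

lemma ln_gap_perm_avg_le:
  assumes "finite S" and u: "\<And>p. p permutes S \<Longrightarrow> 0 < u p" and v: "\<And>p. p permutes S \<Longrightarrow> 0 < v p"
  shows "ln_gap (perm_avg S u) (perm_avg S v) \<le> perm_avg S (\<lambda>p. ln_gap (u p) (v p))"
proof -
  have "perm_avg S (\<lambda>p. ln_gap (u p) (v p))
      = perm_avg S (\<lambda>p. u p * ln (u p / v p)) + perm_avg S (\<lambda>p. v p * ln (v p / u p))"
    unfolding perm_avg_add[symmetric] using u v by (intro perm_avg_cong ln_gap_eq) auto
  moreover have "ln_gap (perm_avg S u) (perm_avg S v)
      = perm_avg S u * ln (perm_avg S u / perm_avg S v) + perm_avg S v * ln (perm_avg S v / perm_avg S u)"
    using assms by (intro ln_gap_eq perm_avg_pos) auto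
  moreover have "perm_avg S u * ln (perm_avg S u / perm_avg S v) \<le> perm_avg S (\<lambda>p. u p * ln (u p / v p))"
    by (rule log_sum_perm_avg) (use assms in auto)
  moreover have "perm_avg S v * ln (perm_avg S v / perm_avg S u) \<le> perm_avg S (\<lambda>p. v p * ln (v p / u p))"
    by (rule log_sum_perm_avg) (use assms in auto)
  ultimately show ?thesis by linarith
qed

text \<open>Entropy is at most the covariance of \<open>g\<close> and \<open>ln g\<close>: by
  concavity of the logarithm, the mean of \<open>ln g\<close> is at most \<open>ln m\<close>, so it
  may replace \<open>ln m\<close> in the subtracted term. The double sum of gaps, divided by twice
  the squared cardinality, is exactly this covariance.\<close>

lemma entropy_le_ln_gap:
  fixes g :: "'a \<Rightarrow> real"
  assumes "finite S" "S \<noteq> {}" and g: "\<And>b. b \<in> S \<Longrightarrow> 0 < g b"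
  defines "m \<equiv> (\<Sum>b\<in>S. g b) / card S"
  shows "(\<Sum>b\<in>S. g b * ln (g b)) / card S - m * ln m
    \<le> (\<Sum>a\<in>S. \<Sum>b\<in>S. ln_gap (g a) (g b)) / (2 * (real (card S))\<^sup>2)"
proof -
  let ?n = "real (card S)"
  have n: "?n > 0" using assms by (simp add: card_gt_0_iff)
  have m: "m > 0" unfolding m_def using assms n by (intro divide_pos_pos sum_pos) auto
  have "(\<Sum>b\<in>S. ln (g b)) \<le> (\<Sum>b\<in>S. ln m + (g b / m - 1))"
  proof (rule sum_mono)
    fix b assume "b \<in> S"
    then have "ln (g b / m) \<le> g b / m - 1" using g m by (intro ln_le_minus_one) auto
    then show "ln (g b) \<le> ln m + (g b / m - 1)" using g[OF \<open>b \<in> S\<close>] m by (simp add: ln_div)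
  qed
  also have "\<dots> = ?n * ln m"
  proof -
    have "(\<Sum>b\<in>S. g b) = ?n * m" using n by (simp add: m_def)
    then show ?thesis using m by (simp add: sum.distrib sum_subtractf sum_divide_distrib[symmetric])
  qed
  finally have *: "m * (\<Sum>b\<in>S. ln (g b)) \<le> m * (?n * ln m)" using m by (intro mult_left_mono) auto
  have "(\<Sum>a\<in>S. \<Sum>b\<in>S. ln_gap (g a) (g b))
      = 2 * (?n * (\<Sum>b\<in>S. g b * ln (g b)) - (\<Sum>b\<in>S. g b) * (\<Sum>b\<in>S. ln (g b)))"
  proof -
    have "ln_gap (g a) (g b) = g a * ln (g a) + g b * ln (g b) - g a * ln (g b) - ln (g a) * g b" for a b
      by (simp add: ln_gap_def algebra_simps)
    then have "(\<Sum>a\<in>S. \<Sum>b\<in>S. ln_gap (g a) (g b))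
      = (\<Sum>a\<in>S. ?n * (g a * ln (g a)) + (\<Sum>b\<in>S. g b * ln (g b)) - g a * (\<Sum>b\<in>S. ln (g b)) - ln (g a) * (\<Sum>b\<in>S. g b))"
      by (simp only: sum.distrib sum_subtractf sum_distrib_left sum_constant)
    also have "\<dots> = 2 * (?n * (\<Sum>b\<in>S. g b * ln (g b)) - (\<Sum>b\<in>S. g b) * (\<Sum>b\<in>S. ln (g b)))"
      by (simp add: sum.distrib sum_subtractf sum_distrib_left[symmetric]) (simp add: sum_distrib_right[symmetric])
    finally show ?thesis .
  qed
  also have "(\<Sum>b\<in>S. g b) = ?n * m" using n by (simp add: m_def)
  finally have "(\<Sum>a\<in>S. \<Sum>b\<in>S. ln_gap (g a) (g b)) / (2 * ?n\<^sup>2)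
     = (\<Sum>b\<in>S. g b * ln (g b)) / ?n - m * (\<Sum>b\<in>S. ln (g b)) / ?n"
    using n by (simp add: field_simps power2_eq_square)
  moreover have "m * (\<Sum>b\<in>S. ln (g b)) / ?n \<le> m * ln m" using * n by (simp add: field_simps)
  ultimately show ?thesis by simp
qed

section \<open>Chain rule and induction on the number of points\<close>

lemma permutes_transpose_compose:
  assumes "q permutes (S - {l})" "l \<in> S" "c \<in> S"
  shows "transpose l c \<circ> q permutes S"
proof (rule permutes_compose)
  show "q permutes S" using assms(1) by (rule permutes_subset) auto
  show "transpose l c permutes S" using assms(2,3) by (rule permutes_swap_id)
qed

text \<open>A coupling of the laws conditioned on the values \<open>a\<close> and \<open>b\<close>
  at \<open>l\<close>: from a permutation with value \<open>a\<close> there, exchange the values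
  \<open>a\<close> and \<open>b\<close>. The permutation \<open>r\<close> expresses this in terms of
  \<open>q\<close>; it fixes \<open>l\<close> (along l, a, b, l), so composing with it preserves the
  average over permutations of \<open>S - {l}\<close>. Joint convexity of the gap finishes the
  proof.\<close>

lemma perm_conditional_ln_gap:
  assumes S: "finite S" "l \<in> S" "a \<in> S" "b \<in> S" and f: "\<And>p. p permutes S \<Longrightarrow> 0 < f p"
  shows "ln_gap (perm_avg (S - {l}) (\<lambda>q. f (transpose l a \<circ> q)))
                (perm_avg (S - {l}) (\<lambda>q. f (transpose l b \<circ> q)))
    \<le> perm_avg (S - {l}) (\<lambda>q. ln_gap (f (transpose l a \<circ> q))
                                  (f (transpose a b \<circ> (transpose l a \<circ> q))))"
proof -
  define r where "r = transpose l b \<circ> transpose a b \<circ> transpose l a"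
  have "r permutes S"
    unfolding r_def using S by (intro permutes_compose permutes_swap_id)
  moreover have "r l = l" by (auto simp: r_def transpose_def)
  ultimately have r: "r permutes (S - {l})"
    by (auto intro: permutes_superset)
  have rb: "transpose l b \<circ> (r \<circ> q) = transpose a b \<circ> (transpose l a \<circ> q)" for q
    by (auto simp: r_def fun_eq_iff)
  note perm = permutes_transpose_compose[OF _ S(2)]
  have "perm_avg (S - {l}) (\<lambda>q. f (transpose l b \<circ> q))
      = perm_avg (S - {l}) (\<lambda>q. f (transpose a b \<circ> (transpose l a \<circ> q)))"
    using perm_avg_compose_left[OF r, of "\<lambda>q. f (transpose l b \<circ> q)"] by (simp only: rb)
  moreover have "0 < f (transpose a b \<circ> (transpose l a \<circ> q))" if "q permutes (S - {l})" for q
    using that S by (intro f permutes_compose[OF perm] permutes_swap_id)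
  ultimately show ?thesis
    using S by (simp only:) (rule ln_gap_perm_avg_le, auto intro!: f perm)
qed

text \<open>Chain rule for entropy: the first sum is the mean conditional entropy given the value at
  \<open>l\<close>. What remains is the entropy of the conditional means \<open>g\<close>, which is
  bounded by gaps between pairs of them and then, through the coupling, by transpositions involving
  \<open>l\<close>.\<close>

lemma perm_ent_le_split:
  assumes S: "finite S" "l \<in> S" and f: "\<And>p. p permutes S \<Longrightarrow> 0 < f p"
  shows "perm_ent S f \<le>
      (\<Sum>b\<in>S. perm_ent (S - {l}) (\<lambda>q. f (transpose l b \<circ> q))) / card S
      + (\<Sum>k\<in>S. perm_avg S (\<lambda>p. ln_gap (f p) (f (p \<circ> transpose l k)))) / (2 * real (card S))"
proof -
  let ?n = "real (card S)"
  define g where "g b = perm_avg (S - {l}) (\<lambda>q. f (transpose l b \<circ> q))" for b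
  have n: "?n > 0" using S by (auto simp: card_gt_0_iff)
  note perm = permutes_transpose_compose[OF _ S(2)]
  have g_pos: "0 < g b" if "b \<in> S" for b
    unfolding g_def using S(1) that by (intro perm_avg_pos f perm) auto
  have avg: "perm_avg S f = (\<Sum>b\<in>S. g b) / ?n"
    unfolding g_def by (rule perm_avg_split[OF S])
  have "perm_avg S (\<lambda>p. f p * ln (f p))
      = (\<Sum>b\<in>S. perm_ent (S - {l}) (\<lambda>q. f (transpose l b \<circ> q)) + g b * ln (g b)) / ?n"
    unfolding perm_ent_def g_def by (subst perm_avg_split[OF S]) simp
  then have "perm_ent S f = (\<Sum>b\<in>S. perm_ent (S - {l}) (\<lambda>q. f (transpose l b \<circ> q))) / ?n
      + ((\<Sum>b\<in>S. g b * ln (g b)) / ?n - (\<Sum>b\<in>S. g b) / ?n * ln ((\<Sum>b\<in>S. g b) / ?n))"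
    unfolding perm_ent_def[of S] avg by (simp add: sum.distrib add_divide_distrib)
  moreover have "(\<Sum>b\<in>S. g b * ln (g b)) / ?n - (\<Sum>b\<in>S. g b) / ?n * ln ((\<Sum>b\<in>S. g b) / ?n)
      \<le> (\<Sum>a\<in>S. \<Sum>b\<in>S. ln_gap (g a) (g b)) / (2 * ?n\<^sup>2)"
    by (rule entropy_le_ln_gap) (use S g_pos in auto)
  moreover have "(\<Sum>a\<in>S. \<Sum>b\<in>S. ln_gap (g a) (g b))
      \<le> ?n * (\<Sum>k\<in>S. perm_avg S (\<lambda>p. ln_gap (f p) (f (p \<circ> transpose l k))))"
  proof -
    \<comment> \<open>\<open>W p\<close> exchanges the value at \<open>l\<close> with every possible
      value \<open>b\<close>. Writing \<open>b = p k\<close> turns the exchange of two values into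
      an exchange of the positions \<open>l\<close> and \<open>k\<close>.\<close>
    define W where "W p = (\<Sum>b\<in>S. ln_gap (f p) (f (transpose (p l) b \<circ> p)))" for p
    have "(\<Sum>a\<in>S. \<Sum>b\<in>S. ln_gap (g a) (g b))
        \<le> (\<Sum>a\<in>S. \<Sum>b\<in>S. perm_avg (S - {l}) (\<lambda>q. ln_gap (f (transpose l a \<circ> q))
                                  (f (transpose a b \<circ> (transpose l a \<circ> q)))))"
      unfolding g_def using S f by (intro sum_mono perm_conditional_ln_gap) auto
    also have "\<dots> = (\<Sum>a\<in>S. perm_avg (S - {l}) (\<lambda>q. W (transpose l a \<circ> q)))"
      unfolding perm_avg_sum[symmetric]
    proof (intro sum.cong refl perm_avg_cong)
      fix a q assume "a \<in> S" "q permutes (S - {l})"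
      then have "q l = l" by (simp add: permutes_not_in)
      then show "(\<Sum>b\<in>S. ln_gap (f (transpose l a \<circ> q)) (f (transpose a b \<circ> (transpose l a \<circ> q))))
          = W (transpose l a \<circ> q)"
        by (simp add: W_def)
    qed
    also have "\<dots> = ?n * perm_avg S W"
      using n by (simp add: perm_avg_split[OF S, of W])
    also have "perm_avg S W = perm_avg S (\<lambda>p. \<Sum>k\<in>S. ln_gap (f p) (f (p \<circ> transpose l k)))"
    proof (rule perm_avg_cong)
      fix p assume p: "p permutes S"
      have "W p = (\<Sum>k\<in>S. ln_gap (f p) (f (transpose (p l) (p k) \<circ> p)))"
        unfolding W_def using sum.permute[OF p, of "\<lambda>b. ln_gap (f p) (f (transpose (p l) b \<circ> p))"]
        by (simp add: o_def)
      moreover have "transpose (p l) (p k) \<circ> p = p \<circ> transpose l k" for k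
        using permutes_inj[OF p] by (auto simp: fun_eq_iff Transposition.transpose_def inj_eq)
      ultimately show "W p = (\<Sum>k\<in>S. ln_gap (f p) (f (p \<circ> transpose l k)))" by simp
    qed
    finally show ?thesis by (simp add: perm_avg_sum)
  qed
  then have "(\<Sum>a\<in>S. \<Sum>b\<in>S. ln_gap (g a) (g b)) / (2 * ?n\<^sup>2)
      \<le> (\<Sum>k\<in>S. perm_avg S (\<lambda>p. ln_gap (f p) (f (p \<circ> transpose l k)))) / (2 * ?n)"
    using n by (simp add: field_simps power2_eq_square)
  ultimately show ?thesis by linarith
qed

text \<open>Induction on the cardinality. The split at one point \<open>l\<close> yields a bound
  depending on \<open>l\<close> only through \<open>R l\<close>; averaging over \<open>l\<close>
  replaces \<open>R l\<close> by \<open>T / card S\<close>, and the constant survives because (n -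
  2) / (n - 1) + 1 / n <= 1.\<close>

theorem perm_modified_log_sobolev:
  assumes "finite S" and "\<And>p. p permutes S \<Longrightarrow> 0 < f p"
  shows "perm_ent S f
    \<le> (\<Sum>i\<in>S. \<Sum>j\<in>S. perm_avg S (\<lambda>p. ln_gap (f p) (f (p \<circ> transpose i j)))) / (2 * real (card S))"
  using assms
proof (induction "card S" arbitrary: S f rule: less_induct)
  case less
  note f = less.prems(2)
  let ?n = "real (card S)"
  define e where "e i j = perm_avg S (\<lambda>p. ln_gap (f p) (f (p \<circ> transpose i j)))" for i j
  define T where "T = (\<Sum>i\<in>S. \<Sum>j\<in>S. e i j)"
  define R where "R l = (\<Sum>k\<in>S. e l k)" for l
  have e_nonneg: "0 \<le> e i j" if "i \<in> S" "j \<in> S" for i j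
    unfolding e_def using that
    by (intro perm_avg_nonneg ln_gap_nonneg f permutes_compose[OF permutes_swap_id])
  have T_nonneg: "0 \<le> T" unfolding T_def by (intro sum_nonneg e_nonneg)
  have sumR: "(\<Sum>l\<in>S. R l) = T" by (simp add: T_def R_def)
  have e_same: "e i i = 0" for i by (simp add: e_def perm_avg_def)
  have e_comm: "e i j = e j i" for i j by (simp add: e_def transpose_commute)
  consider "S = {}" | "card S = 1" | "card S \<ge> 2"
    using card_0_eq[OF \<open>finite S\<close>] by linarith
  then have "perm_ent S f \<le> T / (2 * ?n)"
  proof cases
    \<comment> \<open>The only permutation of the empty set is the identity, so the entropy
      vanishes; the right-hand side is 0 because division by zero yields 0.\<close>
    case 1
    then show ?thesis by (simp add: perm_ent_def perm_avg_def)
  next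
    case 2
    then obtain s where "S = {s}" by (auto simp: card_1_singleton_iff)
    then show ?thesis using T_nonneg by (simp add: perm_ent_def perm_avg_def)
  next
    case 3
    then have n: "?n \<ge> 2" by simp
    have "perm_ent S f \<le> (T - 2 * R l) / (2 * (?n - 1)) + R l / (2 * ?n)" if l: "l \<in> S" for l
    proof -
      have card: "real (card (S - {l})) = ?n - 1" using l less.prems(1) 3
        by (simp add: card_Diff_singleton of_nat_diff)
      note perm = permutes_transpose_compose[OF _ l]
      define X where "X = (\<Sum>b\<in>S. perm_ent (S - {l}) (\<lambda>q. f (transpose l b \<circ> q)))"
      define h where "h i j p = ln_gap (f p) (f (p \<circ> transpose i j))" for i j p
      have "perm_ent (S - {l}) (\<lambda>q. f (transpose l b \<circ> q))
         \<le> (\<Sum>i\<in>S - {l}. \<Sum>j\<in>S - {l}. perm_avg (S - {l}) (\<lambda>q. h i j (transpose l b \<circ> q))) / (2 * (?n - 1))"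
        if "b \<in> S" for b
        using less.hyps[of "S - {l}" "\<lambda>q. f (transpose l b \<circ> q)"] less.prems l that perm 3
        by (simp add: card h_def o_assoc card_Diff1_less)
      then have "(\<Sum>b\<in>S. perm_ent (S - {l}) (\<lambda>q. f (transpose l b \<circ> q)))
        \<le> (\<Sum>b\<in>S. (\<Sum>i\<in>S - {l}. \<Sum>j\<in>S - {l}. perm_avg (S - {l}) (\<lambda>q. h i j (transpose l b \<circ> q))) / (2 * (?n - 1)))"
        by (rule sum_mono)
      also have "\<dots> = (\<Sum>i\<in>S - {l}. \<Sum>j\<in>S - {l}. \<Sum>b\<in>S. perm_avg (S - {l}) (\<lambda>q. h i j (transpose l b \<circ> q))) / (2 * (?n - 1))"
        by (subst sum_divide_distrib[symmetric], subst sum.swap, subst (2) sum.swap) (rule refl)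
      also have "\<dots> = ?n * (\<Sum>i\<in>S - {l}. \<Sum>j\<in>S - {l}. e i j) / (2 * (?n - 1))"
      proof -
        have "(\<Sum>b\<in>S. perm_avg (S - {l}) (\<lambda>q. h i j (transpose l b \<circ> q))) = ?n * e i j" for i j
        proof -
          have "e i j = perm_avg S (h i j)" unfolding e_def h_def[abs_def] ..
          then show ?thesis using n perm_avg_split[OF less.prems(1) l, of "h i j"] by simp
        qed
        then show ?thesis by (simp only: sum_distrib_left)
      qed
      \<comment> \<open>The omitted pairs form the row and the column of \<open>l\<close>. They are
        equal by symmetry of \<open>e\<close>, and their common entry on the diagonal is 0.\<close>
      also have "(\<Sum>i\<in>S - {l}. \<Sum>j\<in>S - {l}. e i j) = T - 2 * R l"
      proof -
        have "(\<Sum>i\<in>S - {l}. \<Sum>j\<in>S - {l}. e i j) = (\<Sum>i\<in>S - {l}. R i - e i l)"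
          using less.prems(1) l by (simp add: R_def sum_diff1)
        also have "\<dots> = (\<Sum>i\<in>S. R i - e i l) - R l"
          using less.prems(1) l by (simp add: sum_diff1 e_same)
        also have "(\<Sum>i\<in>S. e i l) = R l" unfolding R_def by (simp add: e_comm)
        then have "(\<Sum>i\<in>S. R i - e i l) - R l = T - 2 * R l" by (simp add: sum_subtractf sumR)
        finally show ?thesis .
      qed
      finally have "X \<le> ?n * (T - 2 * R l) / (2 * (?n - 1))" unfolding X_def .
      then have "X / ?n \<le> (T - 2 * R l) / (2 * (?n - 1))"
        using n by (simp add: pos_divide_le_eq mult.commute)
      moreover have "perm_ent S f \<le> X / ?n + R l / (2 * ?n)"
        unfolding X_def R_def e_def by (rule perm_ent_le_split) (use less.prems l in auto)
      ultimately show ?thesis by linarith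
    qed
    then have "(\<Sum>l\<in>S. perm_ent S f) \<le> (\<Sum>l\<in>S. (T - 2 * R l) / (2 * (?n - 1)) + R l / (2 * ?n))"
      by (rule sum_mono)
    also have "\<dots> = (?n * T - 2 * T) / (2 * (?n - 1)) + T / (2 * ?n)"
      by (simp add: sum.distrib sum_subtractf sum_divide_distrib[symmetric] sum_distrib_left[symmetric] sumR)
    also have "\<dots> = T / 2 * ((?n - 2) / (?n - 1) + 1 / ?n)"
    proof -
      have "?n * T - 2 * T = T * (?n - 2)" by (simp add: algebra_simps)
      then have "(?n * T - 2 * T) / (2 * (?n - 1)) = T / 2 * ((?n - 2) / (?n - 1))"
        by (simp only: times_divide_times_eq)
      moreover have "T / (2 * ?n) = T / 2 * (1 / ?n)" by simp
      ultimately show ?thesis by (simp only: distrib_left)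
    qed
    also have "\<dots> \<le> T / 2 * 1"
    proof (rule mult_left_mono)
      have "(?n - 2) / (?n - 1) = 1 - 1 / (?n - 1)" using n by (simp add: field_simps)
      moreover have "1 / ?n \<le> 1 / (?n - 1)" using n by (intro divide_left_mono) auto
      ultimately show "(?n - 2) / (?n - 1) + 1 / ?n \<le> 1" by simp
    qed (use T_nonneg in simp)
    finally have "?n * perm_ent S f \<le> T / 2" by simp
    then have "perm_ent S f * ?n \<le> T / 2" by (simp only: mult.commute)
    moreover have "0 < ?n" using n by simp
    ultimately have "perm_ent S f \<le> T / 2 / ?n" by (simp only: pos_le_divide_eq)
    then show ?thesis by simp
  qed
  then show ?case by (simp add: T_def e_def)
qed

subsection \<open>Exponential moments of self-bounding functions\<close>

text \<open>The constant \<open>b\<close> may be negative, so the lemma also applies to \<open>- D\<close>.\<close>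

lemma herbst:
  fixes Y :: "('a \<Rightarrow> 'a) \<Rightarrow> real"
  assumes S: "finite S" and \<Lambda>: "0 < \<Lambda>"
    and ent: "\<And>s. 0 < s \<Longrightarrow> s \<le> \<Lambda> \<Longrightarrow>
      perm_ent S (\<lambda>p. exp (s * Y p)) \<le> b * s\<^sup>2 * perm_avg S (\<lambda>p. Y p * exp (s * Y p))"
  shows "(1 / \<Lambda> - b) * ln (perm_avg S (\<lambda>p. exp (\<Lambda> * Y p))) \<le> perm_avg S Y"
proof -
  define M where "M s = perm_avg S (\<lambda>p. exp (s * Y p))" for s
  define M' where "M' s = perm_avg S (\<lambda>p. Y p * exp (s * Y p))" for s
  define H where "H s = ln (M s)" for s
  define \<psi> where "\<psi> s = H s / s - b * H s" for s
  have M_pos: "0 < M s" for s unfolding M_def by (rule perm_avg_pos[OF S]) simp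
  have dM: "(M has_real_derivative M' s) (at s)" for s
    unfolding M_def[abs_def] M'_def perm_avg_def
    by (intro DERIV_cdivide DERIV_sum) (auto intro!: derivative_eq_intros)
  have dH: "(H has_real_derivative M' s / M s) (at s)" for s
    unfolding H_def[abs_def] by (rule derivative_eq_intros dM M_pos refl)+ (simp add: divide_inverse)
  \<comment> \<open>The entropy bound says exactly that \<open>\<psi>\<close> is nonincreasing; its limit at 0 is the mean of \<open>Y\<close>.\<close>
  have d\<psi>: "(\<psi> has_real_derivative (M' s / M s * s - H s) / (s * s) - b * (M' s / M s)) (at s)"
    if "0 < s" for s
    unfolding \<psi>_def[abs_def] using that
    by (auto intro!: derivative_eq_intros dH)
  have d\<psi>_le: "(M' s / M s * s - H s) / (s * s) - b * (M' s / M s) \<le> 0" if "0 < s" "s \<le> \<Lambda>" for s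
  proof -
    \<comment> \<open>Since \<open>M'\<close> is the derivative of \<open>M\<close>, the left-hand
      side is the entropy of \<open>exp (s * Y p)\<close>. Dividing by \<open>M s\<close> and by the
      square of \<open>s\<close> turns the hypothesis into the sign of the derivative of
      \<open>\<psi>\<close>.\<close>
    have "s * M' s - M s * H s \<le> b * s\<^sup>2 * M' s"
      using ent[OF that] unfolding perm_ent_def
      by (simp add: M_def M'_def H_def perm_avg_cmult[symmetric] mult_ac)
    then have "(s * M' s - M s * H s) / M s \<le> (b * s\<^sup>2 * M' s) / M s"
      using M_pos[of s] by (intro divide_right_mono) auto
    then have "M' s / M s * s - H s \<le> b * (M' s / M s) * (s * s)"
      using M_pos[of s] by (simp add: diff_divide_distrib power2_eq_square mult_ac)
    then have "(M' s / M s * s - H s) / (s * s) \<le> b * (M' s / M s)"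
      using that by (subst pos_divide_le_eq) auto
    then show ?thesis by simp
  qed
  have mono: "\<psi> \<Lambda> \<le> \<psi> s" if "0 < s" "s \<le> \<Lambda>" for s
    using that d\<psi> d\<psi>_le by (intro DERIV_nonpos_imp_nonincreasing[of s \<Lambda> \<psi>]) force+
  have M0: "M 0 = 1" using S by (simp add: M_def)
  have H0: "H 0 = 0" by (simp add: H_def M0)
  have "(H has_real_derivative perm_avg S Y) (at 0)"
    using dH[of 0] by (simp add: M0) (simp add: M'_def)
  then have "((\<lambda>s. H s / s) \<longlongrightarrow> perm_avg S Y) (at 0)"
    by (simp add: has_field_derivative_iff H0)
  moreover have "(H \<longlongrightarrow> 0) (at 0)"
    using DERIV_isCont[OF dH[of 0]] by (simp add: isCont_def H0)
  ultimately have "(\<psi> \<longlongrightarrow> perm_avg S Y - b * 0) (at 0)"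
    unfolding \<psi>_def[abs_def] by (intro tendsto_intros)
  then have "(\<psi> \<longlongrightarrow> perm_avg S Y) (at_right 0)"
    by (auto intro: filterlim_mono at_le)
  moreover have "eventually (\<lambda>s. \<psi> \<Lambda> \<le> \<psi> s) (at_right 0)"
    unfolding eventually_at_right_field using mono \<Lambda> by (intro exI[of _ \<Lambda>]) auto
  ultimately have "\<psi> \<Lambda> \<le> perm_avg S Y"
    by (intro tendsto_lowerbound) (auto simp: trivial_limit_at_right_real)
  then show ?thesis
    by (simp add: \<psi>_def H_def M_def left_diff_distrib)
qed

text \<open>For negative \<open>y\<close> the left side grows exponentially and is of quadratic size
  only in a bounded range. The range -1/4 comes from |s| <= 1/16 and jumps of at most 4.\<close>

lemma one_minus_exp_mult_le:
  fixes y :: real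
  assumes "- 1 / 4 \<le> y"
  shows "(1 - exp (- y)) * y \<le> 2 * y\<^sup>2"
proof (cases "0 \<le> y")
  case True
  have "1 - exp (- y) \<le> y" using exp_ge_add_one_self[of "- y"] by simp
  then have "(1 - exp (- y)) * y \<le> y * y" using True by (rule mult_right_mono)
  also have "\<dots> \<le> 2 * y\<^sup>2" by (simp add: power2_eq_square)
  finally show ?thesis .
next
  case False
  define x where "x = - y"
  have x: "0 \<le> x" "x \<le> 1 / 4" using False assms by (auto simp: x_def)
  have "exp x \<le> 1 + x + x\<^sup>2" using x by (intro exp_bound) auto
  moreover have "x\<^sup>2 \<le> x" using x by (simp add: power2_eq_square mult_left_le)
  ultimately have "exp x - 1 \<le> 2 * x" by simp
  then have "(exp x - 1) * x \<le> 2 * x * x" using x(1) by (rule mult_right_mono)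
  then show ?thesis by (simp add: x_def power2_eq_square algebra_simps)
qed

text \<open>The weight is taken at the larger value \<open>u\<close> whatever the sign of
  \<open>s\<close>. Hence one-sided control of the decrease of \<open>D\<close> under transpositions
  serves both the positive and the negative exponents.\<close>

lemma ln_gap_exp_le:
  assumes "w \<le> u" "u - w \<le> 4" "\<bar>s\<bar> \<le> 1 / 16"
  shows "ln_gap (exp (s * u)) (exp (s * w)) \<le> 2 * s\<^sup>2 * (u - w)\<^sup>2 * exp (s * u)"
proof -
  have "\<bar>s * (u - w)\<bar> \<le> 1 / 16 * 4"
    unfolding abs_mult using assms by (intro mult_mono) auto
  then have "- 1 / 4 \<le> s * (u - w)" by linarith
  from one_minus_exp_mult_le[OF this]
  have "(1 - exp (- (s * (u - w)))) * (s * (u - w)) * exp (s * u) \<le> 2 * (s * (u - w))\<^sup>2 * exp (s * u)"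
    by (rule mult_right_mono) simp
  moreover have "(1 - exp (- (s * (u - w)))) * exp (s * u) = exp (s * u) - exp (s * w)"
    by (simp add: left_diff_distrib exp_add[symmetric] algebra_simps)
  then have "ln_gap (exp (s * u)) (exp (s * w)) = (1 - exp (- (s * (u - w)))) * (s * (u - w)) * exp (s * u)"
    by (simp add: ln_gap_def right_diff_distrib[symmetric])
  ultimately show ?thesis by (simp add: power_mult_distrib mult.assoc)
qed

lemma sum_pairs_diff_square_le:
  fixes v :: "'a \<Rightarrow> real"
  shows "(\<Sum>i\<in>S. \<Sum>j\<in>S. (v i - v j)\<^sup>2) \<le> 2 * real (card S) * (\<Sum>i\<in>S. (v i)\<^sup>2)"
proof -
  have "(\<Sum>i\<in>S. \<Sum>j\<in>S. (v i - v j)\<^sup>2)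
      = (\<Sum>i\<in>S. \<Sum>j\<in>S. (v i)\<^sup>2 + (v j)\<^sup>2 - 2 * (v i * v j))"
    by (simp add: power2_diff mult.assoc)
  also have "\<dots> = 2 * real (card S) * (\<Sum>i\<in>S. (v i)\<^sup>2) - 2 * (\<Sum>i\<in>S. v i)\<^sup>2"
    by (simp add: sum.distrib sum_subtractf sum_distrib_left[symmetric] power2_eq_square sum_product)
  finally show ?thesis by simp
qed

text \<open>Insert \<open>exp (s * D p)\<close> into the Sobolev inequality. The constant is 16 = 2
  * 4 * 2: the factor 2 of \<open>ln_gap_exp_le\<close>, the square of the 2 in \<open>swap\<close>,
  and the 2 of \<open>sum_pairs_diff_square_le\<close>, whose factor \<open>card S\<close>
  cancels.\<close>

lemma self_bounding_perm_ent_le: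
  fixes D :: "('a \<Rightarrow> 'a) \<Rightarrow> real" and v :: "('a \<Rightarrow> 'a) \<Rightarrow> 'a \<Rightarrow> real"
  assumes S: "finite S" "S \<noteq> {}" and s: "\<bar>s\<bar> \<le> 1 / 16"
    and D: "\<And>p. p permutes S \<Longrightarrow> D p = (\<Sum>i\<in>S. (v p i)\<^sup>2)"
    and v: "\<And>p i. p permutes S \<Longrightarrow> i \<in> S \<Longrightarrow> \<bar>v p i\<bar> \<le> 1"
    and swap: "\<And>p i j. p permutes S \<Longrightarrow> i \<in> S \<Longrightarrow> j \<in> S \<Longrightarrow>
      D p - D (p \<circ> transpose i j) \<le> 2 * \<bar>v p i - v p j\<bar>"
  shows "perm_ent S (\<lambda>p. exp (s * D p)) \<le> 16 * s\<^sup>2 * perm_avg S (\<lambda>p. D p * exp (s * D p))"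
proof -
  let ?n = "real (card S)"
  have n: "0 < ?n" using S by (simp add: card_gt_0_iff)
  define B where "B i j p = 2 * s\<^sup>2 * (max 0 (D p - D (p \<circ> transpose i j)))\<^sup>2 * exp (s * D p)" for i j p
  have B_nonneg: "0 \<le> B i j p" for i j p by (simp add: B_def)
  have involutive: "p \<circ> transpose i j \<circ> transpose i j = p" for p :: "'a \<Rightarrow> 'a" and i j
    by (simp add: fun_eq_iff)
  have perm: "p \<circ> transpose i j permutes S" if "p permutes S" "i \<in> S" "j \<in> S" for p i j
    using that by (intro permutes_compose permutes_swap_id)
  have le4: "D p - D (p \<circ> transpose i j) \<le> 4" if "p permutes S" "i \<in> S" "j \<in> S" for p i j
  proof -
    have "\<bar>v p i - v p j\<bar> \<le> 2"
      using v[OF that(1,2)] v[OF that(1,3)] by (simp add: abs_le_iff)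
    then show ?thesis using swap[OF that] by simp
  qed
  \<comment> \<open>The gap is charged to whichever of the two permutations has the larger
    \<open>D\<close>, because \<open>swap\<close> bounds a decrease of \<open>D\<close> by the
    vector \<open>v\<close> at the starting point.\<close>
  have gap: "ln_gap (exp (s * D p)) (exp (s * D (p \<circ> transpose i j))) \<le> B i j p + B i j (p \<circ> transpose i j)"
    if p: "p permutes S" "i \<in> S" "j \<in> S" for p i j
  proof (cases "D (p \<circ> transpose i j) \<le> D p")
    case True
    then have "ln_gap (exp (s * D p)) (exp (s * D (p \<circ> transpose i j))) \<le> B i j p"
      unfolding B_def using ln_gap_exp_le[OF True le4[OF p] s] by (simp add: max_def)
    then show ?thesis using B_nonneg[of i j "p \<circ> transpose i j"] by linarith
  next
    case False
    let ?q = "p \<circ> transpose i j"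
    have le: "D p \<le> D ?q" using False by simp
    have "D ?q - D p \<le> 4" using le4[OF perm[OF p] p(2,3)] by (simp only: involutive)
    then have "ln_gap (exp (s * D p)) (exp (s * D ?q)) \<le> B i j ?q"
      unfolding B_def involutive using ln_gap_exp_le[OF le _ s] le by (simp add: max_def ln_gap_commute)
    then show ?thesis using B_nonneg[of i j p] by linarith
  qed
  have "perm_ent S (\<lambda>p. exp (s * D p)) \<le> (\<Sum>i\<in>S. \<Sum>j\<in>S.
      perm_avg S (\<lambda>p. ln_gap (exp (s * D p)) (exp (s * D (p \<circ> transpose i j))))) / (2 * ?n)"
    using S(1) by (intro perm_modified_log_sobolev) auto
  also have "\<dots> \<le> (\<Sum>i\<in>S. \<Sum>j\<in>S. perm_avg S (\<lambda>p. B i j p + B i j (p \<circ> transpose i j))) / (2 * ?n)"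
    using n gap by (intro divide_right_mono sum_mono perm_avg_mono) auto
  also have "\<dots> = (\<Sum>i\<in>S. \<Sum>j\<in>S. perm_avg S (B i j)) / ?n"
  \<comment> \<open>Composition with a transposition preserves the average, so both charges have the
    same mean; this absorbs the 2 in the denominator.\<close>
  proof -
    have "(\<Sum>i\<in>S. \<Sum>j\<in>S. perm_avg S (\<lambda>p. B i j p + B i j (p \<circ> transpose i j)))
        = (\<Sum>i\<in>S. \<Sum>j\<in>S. 2 * perm_avg S (B i j))"
      by (intro sum.cong refl) (simp add: perm_avg_add perm_avg_compose_right[OF permutes_swap_id])
    then show ?thesis by (simp add: sum_distrib_left[symmetric])
  qed
  also have "\<dots> = perm_avg S (\<lambda>p. \<Sum>i\<in>S. \<Sum>j\<in>S. B i j p) / ?n"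
    by (simp add: perm_avg_sum)
  also have "\<dots> \<le> perm_avg S (\<lambda>p. 16 * s\<^sup>2 * ?n * (D p * exp (s * D p))) / ?n"
  proof (intro divide_right_mono perm_avg_mono)
    fix p assume p: "p permutes S"
    have "(\<Sum>i\<in>S. \<Sum>j\<in>S. B i j p) \<le> (\<Sum>i\<in>S. \<Sum>j\<in>S. 8 * s\<^sup>2 * exp (s * D p) * (v p i - v p j)\<^sup>2)"
    proof (intro sum_mono)
      fix i j assume ij: "i \<in> S" "j \<in> S"
      have "(max 0 (D p - D (p \<circ> transpose i j)))\<^sup>2 \<le> (2 * \<bar>v p i - v p j\<bar>)\<^sup>2"
        using swap[OF p ij] by (intro power_mono) auto
      also have "\<dots> = 4 * (v p i - v p j)\<^sup>2" by (simp add: power_mult_distrib)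
      finally have "2 * s\<^sup>2 * exp (s * D p) * (max 0 (D p - D (p \<circ> transpose i j)))\<^sup>2
          \<le> 2 * s\<^sup>2 * exp (s * D p) * (4 * (v p i - v p j)\<^sup>2)"
        by (rule mult_left_mono) simp
      then show "B i j p \<le> 8 * s\<^sup>2 * exp (s * D p) * (v p i - v p j)\<^sup>2"
        by (simp add: B_def mult_ac)
    qed
    also have "\<dots> = 8 * s\<^sup>2 * exp (s * D p) * (\<Sum>i\<in>S. \<Sum>j\<in>S. (v p i - v p j)\<^sup>2)"
      by (simp only: sum_distrib_left)
    also have "\<dots> \<le> 8 * s\<^sup>2 * exp (s * D p) * (2 * ?n * D p)"
      unfolding D[OF p] by (intro mult_left_mono sum_pairs_diff_square_le) auto
    finally show "(\<Sum>i\<in>S. \<Sum>j\<in>S. B i j p) \<le> 16 * s\<^sup>2 * ?n * (D p * exp (s * D p))"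
      by (simp add: mult_ac)
  qed simp
  also have "\<dots> = 16 * s\<^sup>2 * perm_avg S (\<lambda>p. D p * exp (s * D p))"
    using n by (simp add: perm_avg_cmult)
  finally show ?thesis .
qed

text \<open>Herbst's argument twice: \<open>b = 16\<close> up to 1/64 gives 64 - 16 = 48, and for
  \<open>- D\<close>, where the sign of \<open>b\<close> flips, \<open>b = -16\<close> up to 1/16
  gives 16 + 16 = 32. The endpoint 1/64 makes 1/48 smaller than 1/32, so the product of the two
  bounds is at most 1 when the mean of \<open>D\<close> is nonnegative.\<close>

lemma self_bounding_exp_bounds:
  fixes D :: "('a \<Rightarrow> 'a) \<Rightarrow> real" and v :: "('a \<Rightarrow> 'a) \<Rightarrow> 'a \<Rightarrow> real"
  assumes S: "finite S" "S \<noteq> {}"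
    and D: "\<And>p. p permutes S \<Longrightarrow> D p = (\<Sum>i\<in>S. (v p i)\<^sup>2)"
    and v: "\<And>p i. p permutes S \<Longrightarrow> i \<in> S \<Longrightarrow> \<bar>v p i\<bar> \<le> 1"
    and swap: "\<And>p i j. p permutes S \<Longrightarrow> i \<in> S \<Longrightarrow> j \<in> S \<Longrightarrow>
      D p - D (p \<circ> transpose i j) \<le> 2 * \<bar>v p i - v p j\<bar>"
  shows "perm_avg S (\<lambda>p. exp (D p / 64)) \<le> exp (perm_avg S D / 48)"
    and "perm_avg S (\<lambda>p. exp (- D p / 16)) \<le> exp (- perm_avg S D / 32)"
proof -
  note ent = self_bounding_perm_ent_le[OF S _ D v swap]
  have "(1 / (1 / 64) - 16) * ln (perm_avg S (\<lambda>p. exp (1 / 64 * D p))) \<le> perm_avg S D"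
    by (rule herbst[OF S(1)]) (auto intro!: ent)
  then have "ln (perm_avg S (\<lambda>p. exp (D p / 64))) \<le> perm_avg S D / 48" by simp
  moreover have "0 < perm_avg S (\<lambda>p. exp (D p / 64))" by (rule perm_avg_pos[OF S(1)]) simp
  ultimately show "perm_avg S (\<lambda>p. exp (D p / 64)) \<le> exp (perm_avg S D / 48)"
    by (metis exp_le_cancel_iff exp_ln)
  have "(1 / (1 / 16) - (- 16)) * ln (perm_avg S (\<lambda>p. exp (1 / 16 * - D p))) \<le> perm_avg S (\<lambda>p. - D p)"
  proof (rule herbst[OF S(1)])
    fix s :: real assume s: "0 < s" "s \<le> 1 / 16"
    have "perm_ent S (\<lambda>p. exp (- s * D p)) \<le> 16 * (- s)\<^sup>2 * perm_avg S (\<lambda>p. D p * exp (- s * D p))"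
      by (rule ent) (use s in auto)
    also have "\<dots> = - 16 * s\<^sup>2 * perm_avg S (\<lambda>p. - D p * exp (s * - D p))"
      using perm_avg_cmult[of S "-1" "\<lambda>p. D p * exp (- s * D p)"] by simp
    finally show "perm_ent S (\<lambda>p. exp (s * - D p)) \<le> - 16 * s\<^sup>2 * perm_avg S (\<lambda>p. - D p * exp (s * - D p))"
      by simp
  qed simp
  moreover have "perm_avg S (\<lambda>p. - D p) = - perm_avg S D"
    using perm_avg_cmult[of S "-1" D] by simp
  ultimately have "ln (perm_avg S (\<lambda>p. exp (- D p / 16))) \<le> - perm_avg S D / 32" by simp
  moreover have "0 < perm_avg S (\<lambda>p. exp (- D p / 16))" by (rule perm_avg_pos[OF S(1)]) simp
  ultimately show "perm_avg S (\<lambda>p. exp (- D p / 16)) \<le> exp (- perm_avg S D / 32)"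
    by (metis exp_le_cancel_iff exp_ln)
qed

subsection \<open>Distance to a convex sublevel set\<close>

text \<open>Extensionality makes the cube a full product over all indices, with the factor
  \<open>{undefined}\<close> outside \<open>{1..n}\<close>. All factors are compact, so Tychonoff's
  theorem applies.\<close>

lemma compact_unit_cube: "compact (unit_cube n)"
proof -
  have eq: "unit_cube n = PiE UNIV (\<lambda>i. if i \<in> {1..n} then {0..1} else {undefined})"
    by (auto simp: unit_cube_def PiE_iff extensional_def split: if_splits)
  have "compactin (product_topology (\<lambda>_. euclidean) UNIV) (unit_cube n)"
    unfolding eq compactin_PiE by auto
  then show ?thesis by (simp add: euclidean_product_topology)
qed

lemma euclidean_dist_eq: "euclidean_dist n a b = sqrt (\<Sum>i\<in>{1..n}. (a i - b i)\<^sup>2)"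
  by (simp add: euclidean_dist_def L2_set_def)

lemma lipschitz_on_cube_continuous:
  assumes "lipschitz_on_cube n L \<phi>"
  shows "continuous_on (unit_cube n) \<phi>"
  unfolding continuous_on_def
proof
  fix a assume a: "a \<in> unit_cube n"
  have coord: "continuous_on (unit_cube n) (\<lambda>b. b i :: real)" for i :: nat
    by (rule continuous_on_subset[OF continuous_on_product_coordinates]) simp
  have "continuous_on (unit_cube n) (\<lambda>b. L * euclidean_dist n b a)"
    unfolding euclidean_dist_eq by (intro continuous_intros coord)
  then have "((\<lambda>b. L * euclidean_dist n b a) \<longlongrightarrow> 0) (at a within unit_cube n)"
    using a by (auto simp: continuous_on_def euclidean_dist_eq dest!: bspec[where x = a])
  moreover have "eventually (\<lambda>b. norm (\<phi> b - \<phi> a) \<le> L * euclidean_dist n b a) (at a within unit_cube n)"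
    using a assms unfolding eventually_at_filter lipschitz_on_cube_def by (auto intro: always_eventually)
  ultimately have "((\<lambda>b. \<phi> b - \<phi> a) \<longlongrightarrow> 0) (at a within unit_cube n)"
    by (rule Lim_null_comparison[rotated])
  then show "(\<phi> \<longlongrightarrow> \<phi> a) (at a within unit_cube n)"
    by (simp add: LIM_zero_iff)
qed

text \<open>A nearest point exists by compactness. If the variational inequality failed at some
  \<open>z\<close>, a short move from \<open>y\<close> towards \<open>z\<close> would decrease the
  distance.\<close>

lemma projection_onto_convex:
  fixes K :: "(nat \<Rightarrow> real) set" and x :: "nat \<Rightarrow> real"
  assumes "compact K" "K \<noteq> {}"
    and convex: "\<And>y z u. y \<in> K \<Longrightarrow> z \<in> K \<Longrightarrow> 0 \<le> u \<Longrightarrow> u \<le> 1 \<Longrightarrow>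
      (\<lambda>i\<in>{1..n}. (1 - u) * y i + u * z i) \<in> K"
  obtains y where "y \<in> K" "\<And>z. z \<in> K \<Longrightarrow> (\<Sum>i\<in>{1..n}. (x i - y i) * (z i - y i)) \<le> 0"
proof -
  define h where "h y = (\<Sum>i\<in>{1..n::nat}. (x i - y i :: real)\<^sup>2)" for y
  have coord: "continuous_on K (\<lambda>b. b i :: real)" for i :: nat
    by (rule continuous_on_subset[OF continuous_on_product_coordinates]) simp
  have "continuous_on K h" unfolding h_def[abs_def] by (intro continuous_intros coord)
  then obtain y where y: "y \<in> K" "\<And>z. z \<in> K \<Longrightarrow> h y \<le> h z"
    using continuous_attains_inf[OF assms(1,2)] by blast
  have "(\<Sum>i\<in>{1..n}. (x i - y i) * (z i - y i)) \<le> 0" if z: "z \<in> K" for z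
  proof (rule ccontr)
    define q where "q = (\<Sum>i\<in>{1..n}. (x i - y i) * (z i - y i))"
    define r where "r = (\<Sum>i\<in>{1..n}. (z i - y i)\<^sup>2)"
    assume "\<not> ?thesis"
    then have q: "0 < q" by (simp add: q_def)
    have r: "0 \<le> r" unfolding r_def by (intro sum_nonneg) auto
    \<comment> \<open>The step length makes the first-order gain \<open>2 * u * q\<close> outweigh
      the second-order loss \<open>u\<^sup>2 * r\<close>. The minimum keeps the point on the
      segment, and \<open>r + 1\<close> avoids division by zero.\<close>
    define u where "u = min 1 (q / (r + 1))"
    have u: "0 < u" "u \<le> 1" using q r by (auto simp: u_def)
    have "u * r \<le> q / (r + 1) * r" using r by (intro mult_right_mono) (auto simp: u_def)
    also have "\<dots> \<le> q" using q r by (simp add: field_simps)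
    finally have ur: "u * r \<le> q" .
    have "h y \<le> h (\<lambda>i\<in>{1..n}. (1 - u) * y i + u * z i)"
      using u z y(1) by (intro y(2) convex) auto
    also have "\<dots> = (\<Sum>i\<in>{1..n}. (x i - y i)\<^sup>2 - 2 * u * ((x i - y i) * (z i - y i)) + u\<^sup>2 * (z i - y i)\<^sup>2)"
      unfolding h_def by (intro sum.cong refl) (simp add: power2_eq_square algebra_simps)
    also have "\<dots> = h y - 2 * u * q + u\<^sup>2 * r"
      by (simp add: h_def q_def r_def sum.distrib sum_subtractf sum_distrib_left)
    finally have "u * (2 * q) \<le> u * (u * r)" by (simp add: power2_eq_square mult_ac)
    then have "2 * q \<le> u * r" using u by simp
    then show False using ur q by linarith
  qed
  then show ?thesis using y(1) that by blast
qed

text \<open>The gradient inequality for the convex function squared distance, with gradient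
  \<open>2 * (w - y)\<close> at \<open>w\<close>. It comes from expanding the nonnegative square of
  \<open>(w - y) - (w' - y')\<close>; the hypothesis is the variational inequality of the projection
  \<open>y\<close>, tested at \<open>y'\<close>.\<close>

lemma squared_distance_diff_le:
  fixes w w' y y' :: "'a \<Rightarrow> real"
  assumes "(\<Sum>i\<in>S. (w i - y i) * (y' i - y i)) \<le> 0"
  shows "(\<Sum>i\<in>S. (w i - y i)\<^sup>2) - (\<Sum>i\<in>S. (w' i - y' i)\<^sup>2) \<le> 2 * (\<Sum>i\<in>S. (w i - y i) * (w i - w' i))"
proof -
  have "(w i - y i)\<^sup>2 - (w' i - y' i)\<^sup>2
      \<le> 2 * ((w i - y i) * (w i - w' i)) + 2 * ((w i - y i) * (y' i - y i))" for i
    using zero_le_power2[of "(w i - y i) - (w' i - y' i)"] by (simp add: power2_eq_square algebra_simps)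
  then have "(\<Sum>i\<in>S. (w i - y i)\<^sup>2 - (w' i - y' i)\<^sup>2)
      \<le> (\<Sum>i\<in>S. 2 * ((w i - y i) * (w i - w' i)) + 2 * ((w i - y i) * (y' i - y i)))"
    by (intro sum_mono)
  then show ?thesis
    using assms by (simp add: sum_subtractf sum.distrib sum_distrib_left[symmetric])
qed

lemma sum_mult_transpose_diff:
  fixes v w :: "'a \<Rightarrow> real"
  assumes "finite S" "i \<in> S" "j \<in> S"
  shows "(\<Sum>k\<in>S. v k * (w k - w (transpose i j k))) = (v i - v j) * (w i - w j)"
proof (cases "i = j")
  case False
  have "(\<Sum>k\<in>S. v k * (w k - w (transpose i j k))) = (\<Sum>k\<in>{i, j}. v k * (w k - w (transpose i j k)))"
    using assms by (intro sum.mono_neutral_right) (auto simp: Transposition.transpose_def)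
  then show ?thesis using False by (simp add: algebra_simps)
qed simp

subsection \<open>Concentration\<close>

text \<open>A discrete layer-cake bound, used to estimate a mean by tail probabilities at integer
  levels.\<close>

lemma min_le_sum_of_bool: "min (real N) w \<le> (\<Sum>k<N. of_bool (real k \<le> w))"
  by (induction N) (auto simp: min_def split: if_splits)

context
  fixes n :: nat and x :: "nat \<Rightarrow> real" and L :: real and \<phi> :: "(nat \<Rightarrow> real) \<Rightarrow> real"
  assumes n: "1 \<le> n" and x: "\<And>i. i \<in> {1..n} \<Longrightarrow> x i \<in> {0..1}" and L: "0 < L"
    and lip: "lipschitz_on_cube n L \<phi>" and conv: "convex_on_cube n \<phi>"
begin

private abbreviation (input) "Z \<equiv> permuted_value n x \<phi>"

private abbreviation (input) "avg \<equiv> perm_avg {1..n}"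

text \<open>Supplies the data for \<open>self_bounding_exp_bounds\<close>: \<open>v p\<close> is the
  difference between the permuted vector and its projection to the sublevel set, and
  \<open>D p\<close> is its squared length. The Lipschitz condition along this difference bounds the
  excess of \<open>Z\<close> over \<open>a\<close>.\<close>

lemma permuted_sublevel_distance:
  assumes "y0 \<in> unit_cube n" "\<phi> y0 \<le> a"
  obtains D v where
    "\<And>p. p permutes {1..n} \<Longrightarrow> D p = (\<Sum>i\<in>{1..n}. (v p i)\<^sup>2)"
    "\<And>p i. p permutes {1..n} \<Longrightarrow> i \<in> {1..n} \<Longrightarrow> \<bar>v p i\<bar> \<le> (1 :: real)"
    "\<And>p i j. p permutes {1..n} \<Longrightarrow> i \<in> {1..n} \<Longrightarrow> j \<in> {1..n} \<Longrightarrow>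
      D p - D (p \<circ> transpose i j) \<le> 2 * \<bar>v p i - v p j\<bar>"
    "\<And>p. p permutes {1..n} \<Longrightarrow> (max 0 (Z p - a))\<^sup>2 \<le> L\<^sup>2 * D p"
    "\<And>p. p permutes {1..n} \<Longrightarrow> Z p \<le> a \<Longrightarrow> D p = 0"
proof -
  define K where "K = {y \<in> unit_cube n. \<phi> y \<le> a}"
  have "closedin (top_of_set (unit_cube n)) (unit_cube n \<inter> \<phi> -` {..a})"
    by (intro continuous_closedin_preimage lipschitz_on_cube_continuous[OF lip]) simp
  moreover have "unit_cube n \<inter> \<phi> -` {..a} = K" by (auto simp: K_def)
  ultimately have compact: "compact K"
    using compact_unit_cube closedin_compact by metis
  have nonempty: "K \<noteq> {}" using assms by (auto simp: K_def)
  have convex: "(\<lambda>i\<in>{1..n}. (1 - u) * y i + u * z i) \<in> K"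
    if y: "y \<in> K" and z: "z \<in> K" and u: "0 \<le> u" "u \<le> 1" for y z u
  proof -
    have "(1 - u) * y i + u * z i \<in> {0..1}" if "i \<in> {1..n}" for i
    proof -
      have "y i \<in> {0..1}" "z i \<in> {0..1}"
        using y z that by (auto simp: K_def unit_cube_def PiE_iff)
      then show ?thesis
        using u convex_bound_le[of "y i" 1 "z i" "1 - u" u] by simp
    qed
    then have "(\<lambda>i\<in>{1..n}. (1 - u) * y i + u * z i) \<in> unit_cube n"
      by (simp add: unit_cube_def)
    moreover have "\<phi> (\<lambda>i\<in>{1..n}. (1 - u) * y i + u * z i) \<le> (1 - u) * \<phi> y + u * \<phi> z"
      using conv y z u by (simp add: convex_on_cube_def K_def)
    moreover have "(1 - u) * \<phi> y + u * \<phi> z \<le> a"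
      using y z u by (intro convex_bound_le) (auto simp: K_def)
    ultimately show ?thesis by (simp add: K_def)
  qed
  have "\<exists>y. y \<in> K \<and> (\<forall>z\<in>K. (\<Sum>i\<in>{1..n}. (w i - y i) * (z i - y i)) \<le> 0)" for w
  proof -
    obtain y where "y \<in> K" "\<And>z. z \<in> K \<Longrightarrow> (\<Sum>i\<in>{1..n}. (w i - y i) * (z i - y i)) \<le> 0"
      by (rule projection_onto_convex[OF compact nonempty, of n w]) (use convex in blast)+
    then show ?thesis by blast
  qed
  then have "\<exists>proj. \<forall>w. proj w \<in> K \<and> (\<forall>z\<in>K. (\<Sum>i\<in>{1..n}. (w i - proj w i) * (z i - proj w i)) \<le> 0)"
    by (intro choice allI)
  then obtain proj where proj: "proj w \<in> K"
    "z \<in> K \<Longrightarrow> (\<Sum>i\<in>{1..n}. (w i - proj w i) * (z i - proj w i)) \<le> 0" for w z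
    by blast
  define X where "X p = (\<lambda>i\<in>{1..n}. x (p i))" for p :: "nat \<Rightarrow> nat"
  define v where "v p i = X p i - proj (X p) i" for p i
  define D where "D p = (\<Sum>i\<in>{1..n}. (v p i)\<^sup>2)" for p
  have X: "X p \<in> unit_cube n" if "p permutes {1..n}" for p
    using x permutes_in_image[OF that] by (auto simp: X_def unit_cube_def)
  have Z: "Z p = \<phi> (X p)" for p by (simp add: permuted_value_def X_def)
  show thesis
  proof (rule that[of D v])
    show "D p = (\<Sum>i\<in>{1..n}. (v p i)\<^sup>2)" for p by (simp add: D_def)
  next
    fix p i assume p: "p permutes {1..n}" and i: "i \<in> {1..n}"
    have "X p i \<in> {0..1}" using X[OF p] i by (auto simp: unit_cube_def PiE_iff)
    moreover have "proj (X p) i \<in> {0..1}"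
      using proj(1)[of "X p"] i by (auto simp: K_def unit_cube_def PiE_iff)
    ultimately show "\<bar>v p i\<bar> \<le> 1" by (auto simp: v_def abs_le_iff)
  next
    fix p i j assume p: "p permutes {1..n}" and ij: "i \<in> {1..n}" "j \<in> {1..n}"
    let ?q = "p \<circ> transpose i j"
    have tr: "transpose i j k \<in> {1..n}" if "k \<in> {1..n}" for k
      using that ij permutes_in_image[OF permutes_swap_id[OF ij]] by blast
    \<comment> \<open>The projection of the swapped vector lies in \<open>K\<close>, so it is an
      admissible test point. The two vectors differ only at \<open>i\<close> and \<open>j\<close>,
      where the entries lie in [0,1].\<close>
    have "D p - D ?q \<le> 2 * (\<Sum>k\<in>{1..n}. v p k * (X p k - X ?q k))"
      unfolding D_def v_def by (intro squared_distance_diff_le proj)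
    also have "(\<Sum>k\<in>{1..n}. v p k * (X p k - X ?q k))
        = (\<Sum>k\<in>{1..n}. v p k * (X p k - X p (transpose i j k)))"
      using tr by (intro sum.cong refl) (simp add: X_def)
    also have "\<dots> = (v p i - v p j) * (X p i - X p j)"
      using ij by (intro sum_mult_transpose_diff) auto
    also have "\<dots> \<le> \<bar>v p i - v p j\<bar> * \<bar>X p i - X p j\<bar>"
      by (simp flip: abs_mult)
    also have "\<dots> \<le> \<bar>v p i - v p j\<bar> * 1"
    proof (rule mult_left_mono)
      have "X p i \<in> {0..1}" "X p j \<in> {0..1}"
        using X[OF p] ij by (auto simp: unit_cube_def PiE_iff)
      then show "\<bar>X p i - X p j\<bar> \<le> 1" by (auto simp: abs_le_iff)
    qed simp
    finally show "D p - D ?q \<le> 2 * \<bar>v p i - v p j\<bar>" by (simp only: mult_1_right)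
  next
    fix p assume p: "p permutes {1..n}"
    have "\<phi> (X p) - \<phi> (proj (X p)) \<le> L * euclidean_dist n (X p) (proj (X p))"
      using lip X[OF p] proj(1)[of "X p"] by (force simp: lipschitz_on_cube_def K_def)
    moreover have "\<phi> (proj (X p)) \<le> a" using proj(1) by (simp add: K_def)
    moreover have "euclidean_dist n (X p) (proj (X p)) = sqrt (D p)"
      by (simp add: euclidean_dist_eq D_def v_def)
    ultimately have "max 0 (Z p - a) \<le> L * sqrt (D p)"
      using L by (simp add: Z D_def sum_nonneg)
    then have "(max 0 (Z p - a))\<^sup>2 \<le> (L * sqrt (D p))\<^sup>2" by (intro power_mono) auto
    also have "\<dots> = L\<^sup>2 * D p" by (simp add: power_mult_distrib D_def sum_nonneg)
    finally show "(max 0 (Z p - a))\<^sup>2 \<le> L\<^sup>2 * D p" .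
  next
    fix p assume p: "p permutes {1..n}" and "Z p \<le> a"
    then have "X p \<in> K" using X by (simp add: K_def Z)
    then have "D p \<le> 0"
      using proj(2)[of "X p" "X p"] by (simp add: D_def v_def power2_eq_square)
    moreover have "0 \<le> D p" by (simp add: D_def sum_nonneg)
    ultimately show "D p = 0" by simp
  qed
qed

text \<open>As \<open>D\<close> vanishes where \<open>Z p \<le> a\<close>, the indicator of this
  event is at most \<open>exp (- D p / 16)\<close>, so its probability is at most
  \<open>exp (- avg D / 32)\<close>. The first claim then needs \<open>avg D\<close> bounded below
  by Jensen; the second multiplies by the bound \<open>exp (avg D / 48)\<close> for the exponential
  moment.\<close>

lemma permuted_sublevel_bounds:
  shows "avg (\<lambda>p. of_bool (Z p \<le> a)) \<le> exp (- (max 0 (avg Z - a))\<^sup>2 / (32 * L\<^sup>2))" (is ?lower)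
    and "avg (\<lambda>p. of_bool (Z p \<le> a)) * avg (\<lambda>p. exp ((max 0 (Z p - a))\<^sup>2 / (64 * L\<^sup>2))) \<le> 1" (is ?upper)
proof -
  have "?lower \<and> ?upper"
  proof (cases "\<exists>y\<in>unit_cube n. \<phi> y \<le> a")
    case False
    have "(\<lambda>i\<in>{1..n}. x (p i)) \<in> unit_cube n" if "p permutes {1..n}" for p
      using x permutes_in_image[OF that] by (auto simp: unit_cube_def)
    then have "avg (\<lambda>p. of_bool (Z p \<le> a)) = avg (\<lambda>p. 0)"
      using False by (intro perm_avg_cong) (auto simp: permuted_value_def)
    then show ?thesis by simp
  next
    case True
    then obtain y0 where y0: "y0 \<in> unit_cube n" "\<phi> y0 \<le> a" by blast
    obtain D v where
      D: "\<And>p. p permutes {1..n} \<Longrightarrow> D p = (\<Sum>i\<in>{1..n}. (v p i)\<^sup>2)"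
      and v: "\<And>p i. p permutes {1..n} \<Longrightarrow> i \<in> {1..n} \<Longrightarrow> \<bar>v p i\<bar> \<le> (1 :: real)"
      and swap: "\<And>p i j. p permutes {1..n} \<Longrightarrow> i \<in> {1..n} \<Longrightarrow> j \<in> {1..n} \<Longrightarrow>
        D p - D (p \<circ> transpose i j) \<le> 2 * \<bar>v p i - v p j\<bar>"
      and excess: "\<And>p. p permutes {1..n} \<Longrightarrow> (max 0 (Z p - a))\<^sup>2 \<le> L\<^sup>2 * D p"
      and zero: "\<And>p. p permutes {1..n} \<Longrightarrow> Z p \<le> a \<Longrightarrow> D p = 0"
      by (rule permuted_sublevel_distance[OF y0]) blast
    have S: "finite {1..n}" "{1..n} \<noteq> {}" using n by auto
    have up: "avg (\<lambda>p. exp (D p / 64)) \<le> exp (avg D / 48)"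
      and low: "avg (\<lambda>p. exp (- D p / 16)) \<le> exp (- avg D / 32)"
      by (rule self_bounding_exp_bounds[of "{1..n}" D v, OF S]; fact)+
    have D_nonneg: "0 \<le> avg D" by (rule perm_avg_nonneg) (simp add: D sum_nonneg)
    have "avg (\<lambda>p. of_bool (Z p \<le> a)) \<le> avg (\<lambda>p. exp (- D p / 16))"
      by (rule perm_avg_mono) (auto simp: zero)
    with low have P: "avg (\<lambda>p. of_bool (Z p \<le> a)) \<le> exp (- avg D / 32)" by linarith
    have "(max 0 (avg Z - a))\<^sup>2 \<le> (avg (\<lambda>p. max 0 (Z p - a)))\<^sup>2"
    proof (rule power_mono)
      have "0 \<le> avg (\<lambda>p. max 0 (Z p - a))" by (rule perm_avg_nonneg) simp
      moreover have "avg (\<lambda>p. Z p - a) \<le> avg (\<lambda>p. max 0 (Z p - a))"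
        by (rule perm_avg_mono) simp
      ultimately show "max 0 (avg Z - a) \<le> avg (\<lambda>p. max 0 (Z p - a))"
        by (simp add: perm_avg_diff)
    qed simp
    also have "\<dots> \<le> avg (\<lambda>p. (max 0 (Z p - a))\<^sup>2)" by (rule perm_avg_square_le) simp
    also have "\<dots> \<le> avg (\<lambda>p. L\<^sup>2 * D p)" by (rule perm_avg_mono) (rule excess)
    also have "\<dots> = L\<^sup>2 * avg D" by (rule perm_avg_cmult)
    finally have "(max 0 (avg Z - a))\<^sup>2 / (32 * L\<^sup>2) \<le> avg D / 32"
      using L by (simp add: field_simps)
    then have ?lower using P by (smt (verit) exp_le_cancel_iff minus_divide_left)
    have "avg (\<lambda>p. exp ((max 0 (Z p - a))\<^sup>2 / (64 * L\<^sup>2))) \<le> avg (\<lambda>p. exp (D p / 64))"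
    proof (rule perm_avg_mono)
      fix p assume "p permutes {1..n}"
      from excess[OF this] show "exp ((max 0 (Z p - a))\<^sup>2 / (64 * L\<^sup>2)) \<le> exp (D p / 64)"
        using L by (simp add: field_simps)
    qed
    with up have E: "avg (\<lambda>p. exp ((max 0 (Z p - a))\<^sup>2 / (64 * L\<^sup>2))) \<le> exp (avg D / 48)" by linarith
    have "avg (\<lambda>p. of_bool (Z p \<le> a)) * avg (\<lambda>p. exp ((max 0 (Z p - a))\<^sup>2 / (64 * L\<^sup>2)))
        \<le> exp (- avg D / 32) * exp (avg D / 48)"
      using P E by (intro mult_mono perm_avg_nonneg) auto
    also have "\<dots> = exp (- avg D / 32 + avg D / 48)" by (simp only: exp_add)
    also have "\<dots> \<le> 1" using D_nonneg by simp
    finally show ?thesis using \<open>?lower\<close> by blast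
  qed
  then show ?lower ?upper by blast+
qed

section \<open>Tails around the mean\<close>

lemma permuted_lower_tail:
  assumes "0 \<le> t"
  shows "avg (\<lambda>p. of_bool (Z p \<le> avg Z - t)) \<le> exp (- t\<^sup>2 / (32 * L\<^sup>2))"
  using permuted_sublevel_bounds(1)[of "avg Z - t"] assms by simp

text \<open>Positive and negative parts of the centred variable have equal means, so the lower tail
  suffices. Summing it over the levels \<open>k * L\<close> gives a geometric series.\<close>

lemma permuted_mean_deviation: "avg (\<lambda>p. max 0 (Z p - avg Z)) \<le> 33 * L"
proof -
  let ?m = "avg Z" and ?r = "exp (- 1 / 32) :: real"
  \<comment> \<open>A crude bound, through the sum over all permutations, for every value of
    \<open>(?m - Z p) / L\<close>; it makes the truncation at \<open>N\<close> harmless.\<close>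
  define N where "N = nat \<lceil>\<Sum>p | p permutes {1..n}. \<bar>(?m - Z p) / L\<bar>\<rceil>"
  have N: "(?m - Z p) / L \<le> real N" if "p permutes {1..n}" for p
  proof -
    have "(?m - Z p) / L \<le> \<bar>(?m - Z p) / L\<bar>" by (rule abs_ge_self)
    also have "\<dots> \<le> (\<Sum>p | p permutes {1..n}. \<bar>(?m - Z p) / L\<bar>)"
      using that by (intro member_le_sum) (auto simp: finite_permutations)
    also have "\<dots> \<le> real N" unfolding N_def by linarith
    finally show ?thesis .
  qed
  have "avg (\<lambda>p. max 0 (Z p - ?m)) = avg (\<lambda>p. max 0 (?m - Z p))"
  proof -
    have "avg (\<lambda>p. max 0 (Z p - ?m)) - avg (\<lambda>p. max 0 (?m - Z p)) = avg (\<lambda>p. Z p - ?m)"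
      unfolding perm_avg_diff[symmetric] by (rule perm_avg_cong) auto
    then show ?thesis by (simp add: perm_avg_diff)
  qed
  also have "\<dots> \<le> avg (\<lambda>p. L * (\<Sum>k<N. of_bool (Z p \<le> ?m - real k * L)))"
  proof (rule perm_avg_mono)
    fix p assume p: "p permutes {1..n}"
    have "(?m - Z p) / L \<le> (\<Sum>k<N. of_bool (real k \<le> (?m - Z p) / L))"
      using min_le_sum_of_bool[of N "(?m - Z p) / L"] N[OF p] by simp
    also have "\<dots> = (\<Sum>k<N. of_bool (Z p \<le> ?m - real k * L))"
      using L by (intro sum.cong refl) (auto simp: field_simps)
    finally have "?m - Z p \<le> L * (\<Sum>k<N. of_bool (Z p \<le> ?m - real k * L))"
      using L by (simp add: pos_divide_le_eq mult.commute)
    then show "max 0 (?m - Z p) \<le> L * (\<Sum>k<N. of_bool (Z p \<le> ?m - real k * L))"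
      using L by (simp add: sum_nonneg)
  qed
  also have "\<dots> = L * (\<Sum>k<N. avg (\<lambda>p. of_bool (Z p \<le> ?m - real k * L)))"
    by (simp only: perm_avg_cmult perm_avg_sum)
  also have "\<dots> \<le> L * (\<Sum>k<N. ?r ^ k)"
  proof (intro mult_left_mono sum_mono)
    fix k
    have "avg (\<lambda>p. of_bool (Z p \<le> ?m - real k * L)) \<le> exp (- (real k * L)\<^sup>2 / (32 * L\<^sup>2))"
      using L by (intro permuted_lower_tail) simp
    also have "- (real k * L)\<^sup>2 / (32 * L\<^sup>2) = - (real k)\<^sup>2 / 32"
      using L by (simp add: power_mult_distrib)
    also have "\<dots> \<le> real k * (- 1 / 32)"
    proof -
      have "real k \<le> (real k)\<^sup>2" by (cases "k = 0") (auto simp: power2_eq_square)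
      then show ?thesis by simp
    qed
    finally show "avg (\<lambda>p. of_bool (Z p \<le> ?m - real k * L)) \<le> ?r ^ k"
      by (simp flip: exp_of_nat_mult)
  qed (use L in simp)
  also have "(\<Sum>k<N. ?r ^ k) \<le> 33"
  proof -
    \<comment> \<open>The ratio is at most 32/33, and a geometric series with this ratio sums to at
      most 33.\<close>
    have "33 / 32 \<le> exp (1 / 32 :: real)" using exp_ge_add_one_self[of "1 / 32 :: real"] by simp
    then have r: "?r \<le> 32 / 33" by (simp add: exp_minus field_simps)
    have "(\<Sum>k<N. ?r ^ k) \<le> (\<Sum>k<N. (32 / 33) ^ k)" using r by (intro sum_mono power_mono) auto
    also have "\<dots> = (1 - (32 / 33 :: real) ^ N) * 33" by (subst sum_gp_strict) simp
    also have "\<dots> \<le> 33" by simp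
    finally show ?thesis .
  qed
  finally show ?thesis using L by (simp add: mult.commute)
qed

text \<open>The level \<open>a\<close> lies above the mean by twice the bound \<open>33 * L\<close>,
  so Markov gives P(Z <= a) >= 1/2 and the exponential moment is at most 2. For \<open>t\<close> at
  least twice \<open>66 * L\<close>, the excess over \<open>a\<close> is at least
  \<open>t / 2\<close>, whence 256 = 4 * 64.\<close>

lemma permuted_upper_tail:
  assumes t: "132 * L \<le> t"
  shows "avg (\<lambda>p. of_bool (avg Z + t \<le> Z p)) \<le> 2 * exp (- t\<^sup>2 / (256 * L\<^sup>2))"
proof -
  define a where "a = avg Z + 66 * L"
  let ?P = "avg (\<lambda>p. of_bool (Z p \<le> a))"
  let ?E = "avg (\<lambda>p. exp ((max 0 (Z p - a))\<^sup>2 / (64 * L\<^sup>2)))"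
  have "avg (\<lambda>p. 1 - of_bool (Z p \<le> a)) \<le> avg (\<lambda>p. 1 / (66 * L) * max 0 (Z p - avg Z))"
  proof (rule perm_avg_mono)
    show "1 - of_bool (Z p \<le> a) \<le> 1 / (66 * L) * max 0 (Z p - avg Z)" for p
      using L by (auto simp: a_def max_def field_simps)
  qed
  also have "\<dots> \<le> 1 / (66 * L) * (33 * L)"
    unfolding perm_avg_cmult using L permuted_mean_deviation by (intro mult_left_mono) auto
  also have "\<dots> = 1 / 2" using L by simp
  finally have P: "1 / 2 \<le> ?P" by (simp add: perm_avg_diff)
  have E_nonneg: "0 \<le> ?E" by (rule perm_avg_nonneg) simp
  have "1 / 2 * ?E \<le> ?P * ?E" using P E_nonneg by (rule mult_right_mono)
  then have E: "?E \<le> 2" using permuted_sublevel_bounds(2)[of a] by simp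
  have "avg (\<lambda>p. of_bool (avg Z + t \<le> Z p))
      \<le> avg (\<lambda>p. exp (- t\<^sup>2 / (256 * L\<^sup>2)) * exp ((max 0 (Z p - a))\<^sup>2 / (64 * L\<^sup>2)))"
  proof (rule perm_avg_mono)
    fix p
    show "of_bool (avg Z + t \<le> Z p)
        \<le> exp (- t\<^sup>2 / (256 * L\<^sup>2)) * exp ((max 0 (Z p - a))\<^sup>2 / (64 * L\<^sup>2))"
    proof (cases "avg Z + t \<le> Z p")
      case True
      then have "t / 2 \<le> Z p - a" using t unfolding a_def by linarith
      also have "\<dots> \<le> max 0 (Z p - a)" by simp
      finally have "t / 2 \<le> max 0 (Z p - a)" .
      moreover have "0 \<le> t / 2" using t L by linarith
      ultimately have "(t / 2)\<^sup>2 \<le> (max 0 (Z p - a))\<^sup>2" by (rule power_mono)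
      then have "(t / 2)\<^sup>2 / (64 * L\<^sup>2) \<le> (max 0 (Z p - a))\<^sup>2 / (64 * L\<^sup>2)"
        by (rule divide_right_mono) simp
      moreover have "(t / 2)\<^sup>2 / (64 * L\<^sup>2) = t\<^sup>2 / (256 * L\<^sup>2)" by (simp add: power_divide)
      ultimately show ?thesis by (simp add: exp_add[symmetric])
    qed simp
  qed
  also have "\<dots> = exp (- t\<^sup>2 / (256 * L\<^sup>2)) * ?E" by (rule perm_avg_cmult)
  also have "\<dots> \<le> exp (- t\<^sup>2 / (256 * L\<^sup>2)) * 2" using E by (intro mult_left_mono) auto
  finally show ?thesis by simp
qed

text \<open>The constant is 34848 = 2 * 132 * 132: below the threshold \<open>132 * L\<close> the
  exponent is at least -1/2, so the right-hand side is at least 1. Above it, weakening the exponent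
  from 1/256 pays for reducing the prefactor from 3 to 2.\<close>

lemma permuted_concentration:
  assumes t: "0 < t"
  shows "avg (\<lambda>p. of_bool (t \<le> \<bar>Z p - avg Z\<bar>)) \<le> 2 * exp (- (1 / 34848 * t\<^sup>2 / L\<^sup>2))"
proof -
  define s where "s = t\<^sup>2 / L\<^sup>2"
  have s: "0 \<le> s" by (simp add: s_def)
  show ?thesis
  proof (cases "132 * L \<le> t")
    case True
    have "(132 * L)\<^sup>2 \<le> t\<^sup>2" using True L by (intro power_mono) auto
    then have s_large: "17424 \<le> s" using L by (simp add: s_def field_simps)
    have "avg (\<lambda>p. of_bool (t \<le> \<bar>Z p - avg Z\<bar>))
        \<le> avg (\<lambda>p. of_bool (Z p \<le> avg Z - t) + of_bool (avg Z + t \<le> Z p))"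
      by (rule perm_avg_mono) auto
    also have "\<dots> \<le> exp (- t\<^sup>2 / (32 * L\<^sup>2)) + 2 * exp (- t\<^sup>2 / (256 * L\<^sup>2))"
      unfolding perm_avg_add using permuted_lower_tail permuted_upper_tail True t by (intro add_mono) auto
    also have "\<dots> = exp (- s / 32) + 2 * exp (- s / 256)" by (simp add: s_def mult.commute)
    also have "\<dots> \<le> 3 * exp (- s / 256)" using s by simp
    also have "\<dots> \<le> 2 * exp (- (s / 34848))"
    proof -
      have "3 / 2 \<le> exp (s / 256 - s / 34848)"
        using exp_ge_add_one_self[of "s / 256 - s / 34848"] s_large by linarith
      then have "3 / 2 * exp (- s / 256) \<le> exp (s / 256 - s / 34848) * exp (- s / 256)"
        by (rule mult_right_mono) simp
      also have "\<dots> = exp (- (s / 34848))" by (simp add: exp_add[symmetric])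
      finally show ?thesis by simp
    qed
    finally show ?thesis by (simp add: s_def mult.commute)
  next
    case False
    have "t\<^sup>2 \<le> (132 * L)\<^sup>2" using False t by (intro power_mono) auto
    then have "s \<le> 17424" using L by (simp add: s_def field_simps)
    then have "1 / 2 \<le> exp (- (s / 34848))"
      using exp_ge_add_one_self[of "- (s / 34848)"] by linarith
    moreover have "avg (\<lambda>p. of_bool (t \<le> \<bar>Z p - avg Z\<bar>)) \<le> avg (\<lambda>p. 1)"
      by (rule perm_avg_mono) simp
    ultimately show ?thesis by (simp add: s_def mult.commute)
  qed
qed

end

section \<open>From permutation averages to the probability space\<close>

lemma expectation_uniform_permutation:
  "measure_pmf.expectation (uniform_permutation n) f = perm_avg {1..n} f"
proof -
  have "{p. p permutes {1..n}} \<noteq> {}" by (auto intro: permutes_id)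
  then show ?thesis
    unfolding uniform_permutation_def
    by (subst integral_pmf_of_set)
      (auto simp: finite_permutations perm_avg_def card_permutations[OF refl])
qed

lemma prob_uniform_permutation:
  "measure_pmf.prob (uniform_permutation n) {p. Q p} = perm_avg {1..n} (\<lambda>p. of_bool (Q p))"
proof -
  have "measure_pmf.prob (uniform_permutation n) {p. Q p}
      = measure_pmf.expectation (uniform_permutation n) (indicator {p. Q p})"
    by simp
  also have "\<dots> = perm_avg {1..n} (indicator {p. Q p})"
    by (rule expectation_uniform_permutation)
  also have "\<dots> = perm_avg {1..n} (\<lambda>p. of_bool (Q p))"
    by (rule perm_avg_cong) (simp add: indicator_def)
  finally show ?thesis .
qed

theorem theorem3p1:
  shows "\<exists>c::real. c > 0 \<and>
    (\<forall>(n::nat) (x :: nat \<Rightarrow> real) (L::real) (\<phi> :: (nat \<Rightarrow> real) \<Rightarrow> real) (t::real).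
       n \<ge> 1 \<longrightarrow> (\<forall>i\<in>{1..n}. x i \<in> {0..1}) \<longrightarrow> L > 0 \<longrightarrow>
       lipschitz_on_cube n L \<phi> \<longrightarrow> convex_on_cube n \<phi> \<longrightarrow> t > 0 \<longrightarrow>
       (let P = uniform_permutation n; Z = permuted_value n x \<phi> in
        measure_pmf.prob P {\<pi>. \<bar>Z \<pi> - measure_pmf.expectation P Z\<bar> \<ge> t}
          \<le> 2 * exp (- (c * t\<^sup>2 / L\<^sup>2))))"
  unfolding Let_def prob_uniform_permutation expectation_uniform_permutation
  by (rule exI[of _ "1 / 34848"]) (use permuted_concentration in auto)

end
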